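(* Let $l$ be a positive integer. Define the sequence $(m_i)_{i\ge 0}$ of non-negative integers by $$ m_i := \begin{cases} 2^{i+1}, & 0\le i\le 2l-2,\\ 2^{2l}-1, & i=2l-1,\\ 2^{i+1}-2^{i-2l}, & i\ge 2l. \end{cases} $$ Let $A_0:=\{0\}$, $B_0:=\{1\}$, and for $i=1,2,\dots$ define recursively $$ A_i := A_{i-1}\cup (m_{i-1}+B_{i-1}), \qquad B_i := B_{i-1}\cup (m_{i-1}+A_{i-1}). $$ Let $A:=\bigcup_{i\ge 0}A_i$ and $B:=\bigcup_{i\ge 0}B_i$. Then $R_A=R_B$, $A\cup B=\mathbb{N}_0$, and $A\cap B=(2^{2l}-1)+(2^{2l+1}-1)\mathbb{N}_0$.
   Context: $\mathbb{N}_0$ denotes the set of non-negative integers. For $A\subseteq\mathbb{N}_0$, the representation function $R_A$ is defined for each integer $n$ by $R_A(n):=|\{(a',a'')\in A\times A : n=a'+a'',\ a'<a''\}|$, i.e. the number of unordered representations of $n$ as a sum of two distinct elements of $A$. For an integer $m$ and a set $X$ of integers, $m+X:=\{m+x : x\in X\}$ and $kX:=\{kx: x\in X\}$; thus $r+k\mathbb{N}_0=\{r,r+k,r+2k,\dots\}$. *)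

theory Defs
  imports Main
begin

definition rep_fun :: "nat set \<Rightarrow> int \<Rightarrow> nat" where
  "rep_fun A n = card {(a', a''). a' \<in> A \<and> a'' \<in> A \<and> n = int a' + int a'' \<and> a' < a''}"

text \<open>
  For \<open>l > 0\<close> no subtraction below is truncated, so natural-number arithmetic
  agrees with integer arithmetic.
\<close>

definition m_seq :: "nat \<Rightarrow> nat \<Rightarrow> nat" where
  "m_seq l i =
     (if i \<le> 2 * l - 2 then 2 ^ (i + 1)
      else if i = 2 * l - 1 then 2 ^ (2 * l) - 1
      else 2 ^ (i + 1) - 2 ^ (i - 2 * l))"

fun A_seq :: "nat \<Rightarrow> nat \<Rightarrow> nat set" and B_seq :: "nat \<Rightarrow> nat \<Rightarrow> nat set" where
  "A_seq l 0 = {0}"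
| "A_seq l (Suc i) = A_seq l i \<union> (+) (m_seq l i) ` B_seq l i"
| "B_seq l 0 = {1}"
| "B_seq l (Suc i) = B_seq l i \<union> (+) (m_seq l i) ` A_seq l i"

definition A_lim :: "nat \<Rightarrow> nat set" where
  "A_lim l = (\<Union>i. A_seq l i)"

definition B_lim :: "nat \<Rightarrow> nat set" where
  "B_lim l = (\<Union>i. B_seq l i)"

end

theory Submission
  imports Defs
begin

text \<open>
  The sets \<open>A\<close> and \<open>B\<close> consist of the subset sums, with an even respectively odd number of
  summands, of \<open>1, m\<^sub>0, m\<^sub>1, \<dots>\<close>. With \<open>c = 2 ^ (2 * l) - 1\<close> and \<open>M = 2 ^ (2 * l + 1) - 1\<close> this
  sequence reads \<open>1, 2, 4, \<dots>, 2 ^ (2 * l - 1), c, M, 2 * M, 4 * M, \<dots>\<close>. The summands up to \<open>c\<close> reach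
  every \<open>r < M\<close>, and reach it once, except for \<open>r = c\<close>, which is both the full sum of the \<open>2 * l\<close>
  powers of two (an even number of summands) and the single summand \<open>c\<close>. The remaining summands
  generate the multiples of \<open>M\<close> uniquely, which gives the union and the intersection.

  The only coincidence of subset sums is thus between sums of different parity, so the two parts
  of each \<open>A\<^sub>i\<^sub>+\<^sub>1 = A\<^sub>i \<union> (m\<^sub>i + B\<^sub>i)\<close> and \<open>B\<^sub>i\<^sub>+\<^sub>1 = B\<^sub>i \<union> (m\<^sub>i + A\<^sub>i)\<close> are disjoint. Pairs within one
  part are then matched by induction, and \<open>(a, m\<^sub>i + b)\<close> is matched with \<open>(b, m\<^sub>i + a)\<close>.
\<close>

section \<open>Counting pairs in unions and translates\<close>

definition pair_count :: "nat set \<Rightarrow> nat set \<Rightarrow> int \<Rightarrow> nat" where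
  "pair_count X Y n = card {(x, y). x \<in> X \<and> y \<in> Y \<and> n = int x + int y \<and> x \<noteq> y}"

lemma finite_sum_pairs:
  fixes n :: int
  assumes "\<And>x y. P x y \<Longrightarrow> n = int x + int y"
  shows "finite {(x, y). P x y}"
proof (rule finite_subset)
  show "{(x, y). P x y} \<subseteq> {..nat n} \<times> {..nat n}"
    using assms by force
qed simp

lemma pair_count_commute: "pair_count X Y n = pair_count Y X n"
  unfolding pair_count_def
  by (rule bij_betw_same_card[where f = prod.swap], rule bij_betw_byWitness[where f' = prod.swap]) auto

lemma pair_count_self: "pair_count X X n = 2 * rep_fun X n"
proof -
  let ?S = "{(x, y). x \<in> X \<and> y \<in> X \<and> n = int x + int y \<and> x < y}"
  let ?T = "{(x, y). x \<in> X \<and> y \<in> X \<and> n = int x + int y \<and> y < x}"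
  have "{(x, y). x \<in> X \<and> y \<in> X \<and> n = int x + int y \<and> x \<noteq> y} = ?S \<union> ?T"
    by auto
  moreover have "finite ?S" "finite ?T"
    by (rule finite_sum_pairs[where n = n]; simp)+
  moreover have "?S \<inter> ?T = {}"
    by auto
  moreover have "card ?T = card ?S"
    by (rule bij_betw_same_card[where f = prod.swap], rule bij_betw_byWitness[where f' = prod.swap]) auto
  ultimately show ?thesis
    by (simp add: pair_count_def rep_fun_def card_Un_disjoint)
qed

lemma pair_count_Un_left:
  assumes "X \<inter> X' = {}"
  shows "pair_count (X \<union> X') Y n = pair_count X Y n + pair_count X' Y n"
proof -
  let ?P = "\<lambda>X. {(x, y). x \<in> X \<and> y \<in> Y \<and> n = int x + int y \<and> x \<noteq> y}"
  have "?P (X \<union> X') = ?P X \<union> ?P X'"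
    by auto
  moreover have "finite (?P X)" "finite (?P X')"
    by (rule finite_sum_pairs[where n = n]; simp)+
  moreover have "?P X \<inter> ?P X' = {}"
    using assms by auto
  ultimately show ?thesis
    by (simp add: pair_count_def card_Un_disjoint)
qed

text \<open>Ordered pairs make \<open>pair_count\<close> symmetric and additive over disjoint
  unions, so it expands like a square with a doubled cross term; \<open>pair_count_self\<close> then
  allows halving.\<close>

lemma rep_fun_Un_disjoint:
  assumes "X \<inter> Y = {}"
  shows "rep_fun (X \<union> Y) n = rep_fun X n + rep_fun Y n + pair_count X Y n"
proof -
  have "pair_count Z (X \<union> Y) n = pair_count X Z n + pair_count Y Z n" for Z
    using pair_count_commute[of Z "X \<union> Y"] pair_count_Un_left[OF assms] by simp
  then have "pair_count (X \<union> Y) (X \<union> Y) n =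
      pair_count X X n + pair_count Y Y n + 2 * pair_count X Y n"
    using pair_count_Un_left[OF assms] pair_count_commute[of Y X] by simp
  then show ?thesis
    by (simp add: pair_count_self)
qed

lemma rep_fun_translate: "rep_fun ((+) m ` X) n = rep_fun X (n - 2 * int m)"
  unfolding rep_fun_def
  by (rule bij_betw_same_card[where f = "\<lambda>(x, y). (x - m, y - m)"],
      rule bij_betw_byWitness[where f' = "\<lambda>(x, y). (x + m, y + m)"]) (auto simp: image_iff)

text \<open>The exchange \<open>(x, m + y)\<close> to \<open>(y, m + x)\<close> keeps the sum; the
  two disjointness hypotheses keep it from producing a pair of equal entries in either
  direction.\<close>

lemma pair_count_translate_swap:
  assumes "X \<inter> (+) m ` Y = {}" and "Y \<inter> (+) m ` X = {}"
  shows "pair_count X ((+) m ` Y) n = pair_count Y ((+) m ` X) n"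
  unfolding pair_count_def
  by (rule bij_betw_same_card[where f = "\<lambda>(x, y). (y - m, x + m)"],
      rule bij_betw_byWitness[where f' = "\<lambda>(x, y). (y - m, x + m)"]) (use assms in \<open>auto simp: add.commute\<close>)

lemma rep_fun_exchange_step:
  assumes "rep_fun X = rep_fun Y"
    and "X \<inter> (+) m ` Y = {}" and "Y \<inter> (+) m ` X = {}"
  shows "rep_fun (X \<union> (+) m ` Y) = rep_fun (Y \<union> (+) m ` X)"
  using assms
  by (simp add: fun_eq_iff rep_fun_Un_disjoint rep_fun_translate pair_count_translate_swap)

section \<open>The stages \<open>A_seq\<close> and \<open>B_seq\<close>\<close>

lemma m_seq_less: "i \<le> 2 * l - 2 \<Longrightarrow> m_seq l i = 2 ^ (i + 1)"
  by (simp add: m_seq_def)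

lemma m_seq_mid: "l > 0 \<Longrightarrow> m_seq l (2 * l - 1) = 2 ^ (2 * l) - 1"
  by (simp add: m_seq_def)

lemma m_seq_ge: "l > 0 \<Longrightarrow> m_seq l (2 * l + k) = 2 ^ k * (2 ^ (2 * l + 1) - 1)"
  by (auto simp: m_seq_def power_add algebra_simps)

lemma interval_Un_translate:
  fixes m n :: nat
  assumes "m \<le> n"
  shows "{..<n} \<union> (+) m ` {..<n} = {..<m + n}"
proof -
  have "x \<in> (+) m ` {..<n}" if "x < m + n" "\<not> x < n" for x
    using that assms by (intro image_eqI[of _ _ "x - m"]) auto
  then show ?thesis
    by auto
qed

text \<open>Up to this stage the summands are \<open>1, 2, \<dots>, 2 ^ i\<close>, so binary digits
  are unique and their sum has a parity. The last clause tracks the number with all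
  \<open>i + 1\<close> digits one; at \<open>i = 2 * l - 1\<close> it puts \<open>c\<close> into the
  even side.\<close>

lemma seq_binary:
  assumes "i \<le> 2 * l - 1"
  shows "A_seq l i \<union> B_seq l i = {..<2 ^ (i + 1)} \<and> A_seq l i \<inter> B_seq l i = {} \<and> 0 \<in> A_seq l i \<and>
    2 ^ (i + 1) - 1 \<in> (if odd i then A_seq l i else B_seq l i)"
  using assms
proof (induction i)
  case 0
  show ?case
    by auto
next
  case (Suc i)
  let ?A = "A_seq l i" and ?B = "B_seq l i"
  define m :: nat where "m = 2 ^ (i + 1)"
  have m: "m_seq l i = m" "m > 0"
    using Suc.prems by (auto simp: m_seq_less m_def)
  have IH: "?A \<union> ?B = {..<m}" "?A \<inter> ?B = {}" "0 \<in> ?A" "m - 1 \<in> (if odd i then ?A else ?B)"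
    using Suc by (auto simp: m_def)
  have lt: "x < m" if "x \<in> ?A \<or> x \<in> ?B" for x
    using IH(1) that by blast
  have "A_seq l (Suc i) \<union> B_seq l (Suc i) = (?A \<union> ?B) \<union> (+) m ` (?A \<union> ?B)"
    by (auto simp: m)
  also have "\<dots> = {..<2 ^ (Suc i + 1)}"
    unfolding IH(1) by (subst interval_Un_translate) (auto simp: m_def)
  finally have un: "A_seq l (Suc i) \<union> B_seq l (Suc i) = {..<2 ^ (Suc i + 1)}" .
  have int: "A_seq l (Suc i) \<inter> B_seq l (Suc i) = {}"
    using IH(2) lt by (fastforce simp: m)
  have "2 ^ (Suc i + 1) - 1 = m + (m - 1)"
    using m(2) by (simp add: m_def)
  then have "2 ^ (Suc i + 1) - 1 \<in> (if odd (Suc i) then A_seq l (Suc i) else B_seq l (Suc i))"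
    using IH(4) by (auto simp: m)
  then show ?case
    using un int IH(3) by auto
qed

lemma seq_mid:
  assumes "l > 0"
  defines "c \<equiv> 2 ^ (2 * l) - 1"
  shows "A_seq l (2 * l - 1) \<union> B_seq l (2 * l - 1) = {..c}"
    and "A_seq l (2 * l - 1) \<inter> B_seq l (2 * l - 1) = {}"
    and "0 \<in> A_seq l (2 * l - 1)" and "c \<in> A_seq l (2 * l - 1)"
proof -
  have *: "{..c} = {..<2 ^ (2 * l)}"
    unfolding c_def by (simp add: lessThan_Suc_atMost[symmetric])
  show "A_seq l (2 * l - 1) \<union> B_seq l (2 * l - 1) = {..c}"
    "A_seq l (2 * l - 1) \<inter> B_seq l (2 * l - 1) = {}"
    "0 \<in> A_seq l (2 * l - 1)" "c \<in> A_seq l (2 * l - 1)"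
    using seq_binary[of "2 * l - 1" l] assms unfolding * by auto
qed

lemma seq_tail:
  assumes "l > 0"
  defines "c \<equiv> 2 ^ (2 * l) - 1" and "M \<equiv> 2 ^ (2 * l + 1) - 1"
  shows "A_seq l (2 * l + k) \<union> B_seq l (2 * l + k) = {..<2 ^ k * M} \<and>
    A_seq l (2 * l + k) \<inter> B_seq l (2 * l + k) = (\<lambda>q. c + M * q) ` {..<2 ^ k}"
proof (induction k)
  case 0
  let ?A = "A_seq l (2 * l - 1)" and ?B = "B_seq l (2 * l - 1)"
  have Suc: "2 * l = Suc (2 * l - 1)"
    using assms by simp
  have step: "A_seq l (2 * l) = ?A \<union> (+) c ` ?B" "B_seq l (2 * l) = ?B \<union> (+) c ` ?A"
    using m_seq_mid[OF assms(1)] Suc c_def by (metis A_seq.simps(2), metis B_seq.simps(2))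
  note mid = seq_mid[OF assms(1), folded c_def]
  have lt: "x \<le> c" if "x \<in> ?A \<or> x \<in> ?B" for x
    using mid(1) that by blast
  \<comment> \<open>An interval of length \<open>Suc c\<close> is shifted by only \<open>c\<close>:
    this off-by-one causes the single overlap.\<close>
  have M: "M = c + Suc c"
    by (simp add: M_def c_def)
  have "A_seq l (2 * l) \<union> B_seq l (2 * l) = (?A \<union> ?B) \<union> (+) c ` (?A \<union> ?B)"
    unfolding step by auto
  also have "\<dots> = {..<M}"
    unfolding mid(1) M lessThan_Suc_atMost[symmetric] by (rule interval_Un_translate) simp
  finally have un: "A_seq l (2 * l) \<union> B_seq l (2 * l) = {..<M}" .
  \<comment> \<open>Since \<open>?A\<close> and \<open>?B\<close> are disjoint, a common element
    lies in one of them and in its own translate, hence is both at most and at least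
    \<open>c\<close>.\<close>
  have "x = c" if "x \<in> A_seq l (2 * l) \<inter> B_seq l (2 * l)" for x
    using that mid(2) lt unfolding step by fastforce
  moreover have "c \<in> A_seq l (2 * l) \<inter> B_seq l (2 * l)"
    using mid(3,4) unfolding step by force
  ultimately have "A_seq l (2 * l) \<inter> B_seq l (2 * l) = {c}"
    by blast
  then show ?case
    using un by (simp add: lessThan_Suc)
next
  case (Suc k)
  let ?A = "A_seq l (2 * l + k)" and ?B = "B_seq l (2 * l + k)"
  define m where "m = 2 ^ k * M"
  have step: "A_seq l (2 * l + Suc k) = ?A \<union> (+) m ` ?B"
    "B_seq l (2 * l + Suc k) = ?B \<union> (+) m ` ?A"
    using m_seq_ge[OF assms(1), of k] by (simp_all add: m_def M_def)
  have IH: "?A \<union> ?B = {..<m}" "?A \<inter> ?B = (\<lambda>q. c + M * q) ` {..<2 ^ k}"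
    using Suc by (auto simp: m_def)
  have lt: "x < m" if "x \<in> ?A \<or> x \<in> ?B" for x
    using IH(1) that by blast
  have "A_seq l (2 * l + Suc k) \<union> B_seq l (2 * l + Suc k) = (?A \<union> ?B) \<union> (+) m ` (?A \<union> ?B)"
    unfolding step by auto
  also have "\<dots> = {..<2 ^ Suc k * M}"
    unfolding IH(1) by (subst interval_Un_translate) (auto simp: m_def)
  finally have un: "A_seq l (2 * l + Suc k) \<union> B_seq l (2 * l + Suc k) = {..<2 ^ Suc k * M}" .
  \<comment> \<open>Old elements lie below \<open>m\<close>, so old and translated parts never meet;
    translating by \<open>m = 2 ^ k * M\<close> adds \<open>2 ^ k\<close> to
    \<open>q\<close>.\<close>
  have "A_seq l (2 * l + Suc k) \<inter> B_seq l (2 * l + Suc k) = (?A \<inter> ?B) \<union> (+) m ` (?A \<inter> ?B)"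
    unfolding step using lt by fastforce
  also have "\<dots> = (\<lambda>q. c + M * q) ` ({..<2 ^ k} \<union> (+) (2 ^ k) ` {..<2 ^ k})"
    unfolding IH(2) image_Un image_image by (simp add: m_def algebra_simps)
  also have "\<dots> = (\<lambda>q. c + M * q) ` {..<2 ^ Suc k}"
    by (subst interval_Un_translate) auto
  finally show ?case
    using un by blast
qed

lemma seq_disjoint_translate:
  assumes "l > 0"
  shows "A_seq l i \<inter> (+) (m_seq l i) ` B_seq l i = {} \<and>
    B_seq l i \<inter> (+) (m_seq l i) ` A_seq l i = {}"
proof -
  consider "i \<le> 2 * l - 2" | "i = 2 * l - 1" | k where "i = 2 * l + k"
  proof -
    have "i \<le> 2 * l - 2 \<or> i = 2 * l - 1 \<or> 2 * l \<le> i"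
      by linarith
    then show thesis
      using that le_Suc_ex[of "2 * l" i] by blast
  qed
  then show ?thesis
  proof cases
    case 1
    then have "A_seq l i \<union> B_seq l i = {..<m_seq l i}"
      using seq_binary[of i l] by (simp add: m_seq_less)
    then have "x < m_seq l i" if "x \<in> A_seq l i \<or> x \<in> B_seq l i" for x
      using that by blast
    then show ?thesis
      by fastforce
  next
    case 2
    note mid = seq_mid[OF assms, folded 2]
    have m: "m_seq l i = 2 ^ (2 * l) - 1"
      using m_seq_mid[OF assms] 2 by simp
    have "x \<le> m_seq l i" if "x \<in> A_seq l i \<or> x \<in> B_seq l i" for x
      using mid(1) that unfolding m by blast
    \<comment> \<open>By size only \<open>m_seq l i\<close> itself could be shared, as an old
      element and as the translate of \<open>0\<close>; both of these sources lie in
      \<open>A_seq l i\<close>.\<close>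
    moreover have "0 \<notin> B_seq l i" "m_seq l i \<notin> B_seq l i"
      using mid(2-4) unfolding m by blast+
    ultimately show ?thesis
      by (fastforce simp: image_iff)
  next
    case 3
    then have "A_seq l i \<union> B_seq l i = {..<m_seq l i}"
      using seq_tail[OF assms, of k] m_seq_ge[OF assms, of k] by simp
    then have "x < m_seq l i" if "x \<in> A_seq l i \<or> x \<in> B_seq l i" for x
      using that by blast
    then show ?thesis
      by fastforce
  qed
qed

lemma rep_fun_seq_eq: "l > 0 \<Longrightarrow> rep_fun (A_seq l i) = rep_fun (B_seq l i)"
proof (induction i)
  case 0
  have "rep_fun {a} n = 0" for a n
    by (auto simp: rep_fun_def card_eq_0_iff)
  then show ?case
    by (simp add: fun_eq_iff)
next
  case (Suc i)
  then show ?case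
    using rep_fun_exchange_step[of "A_seq l i" "B_seq l i" "m_seq l i"]
      seq_disjoint_translate[of l i] by simp
qed

section \<open>Passage to the limit sets\<close>

lemma seq_mono:
  assumes "i \<le> j"
  shows "A_seq l i \<subseteq> A_seq l j" "B_seq l i \<subseteq> B_seq l j"
  using assms by (induction j) (auto simp: le_Suc_eq)

lemma m_seq_gt:
  assumes "l > 0"
  shows "i < m_seq l i"
proof -
  have pow: "(2::nat) ^ (i - 2 * l) \<le> 2 ^ i" "i < 2 ^ i" "(2::nat) ^ (i + 1) = 2 * 2 ^ i"
    by (simp_all add: power_increasing)
  have "m_seq l i = 2 ^ (i + 1) \<or> m_seq l i = 2 ^ (i + 1) - 1 \<or>
      m_seq l i = 2 ^ (i + 1) - 2 ^ (i - 2 * l)"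
    using assms by (auto simp: m_seq_def simp flip: power_Suc)
  then show ?thesis
    using pow by linarith
qed

text \<open>Whatever is added after stage \<open>i\<close> is at least some \<open>m_seq l j\<close>
  with \<open>j \<ge> i\<close>, hence exceeds \<open>x\<close>.\<close>

lemma lim_below:
  assumes "l > 0" and "x < i"
  shows "x \<in> A_lim l \<longleftrightarrow> x \<in> A_seq l i" "x \<in> B_lim l \<longleftrightarrow> x \<in> B_seq l i"
proof -
  have stable: "(x \<in> A_seq l (i + k) \<longrightarrow> x \<in> A_seq l i) \<and> (x \<in> B_seq l (i + k) \<longrightarrow> x \<in> B_seq l i)"
    for k
  proof (induction k)
    case (Suc k)
    have "x < m_seq l (i + k)"
      using m_seq_gt[OF assms(1), of "i + k"] assms(2) by simp
    then show ?case
      using Suc by auto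
  qed simp
  have *: "(x \<in> A_seq l j \<longrightarrow> x \<in> A_seq l i) \<and> (x \<in> B_seq l j \<longrightarrow> x \<in> B_seq l i)" for j
    using stable[of j] seq_mono[of j "i + j" l] by auto
  show "x \<in> A_lim l \<longleftrightarrow> x \<in> A_seq l i" "x \<in> B_lim l \<longleftrightarrow> x \<in> B_seq l i"
    using * by (auto simp: A_lim_def B_lim_def)
qed

lemma rep_fun_cong:
  assumes "\<And>x. int x \<le> n \<Longrightarrow> x \<in> X \<longleftrightarrow> x \<in> Y"
  shows "rep_fun X n = rep_fun Y n"
  unfolding rep_fun_def by (rule arg_cong[where f = card]) (use assms in auto)

theorem theorem1:
  fixes l :: nat
  assumes "l > 0"
  shows "rep_fun (A_lim l) = rep_fun (B_lim l) \<and>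
    A_lim l \<union> B_lim l = UNIV \<and>
    A_lim l \<inter> B_lim l =
      (+) (2 ^ (2 * l) - 1) ` ((*) (2 ^ (2 * l + 1) - 1) ` (UNIV :: nat set))"
proof (intro conjI)
  show "rep_fun (A_lim l) = rep_fun (B_lim l)"
  proof
    fix n
    \<comment> \<open>Summands of \<open>n\<close> are at most \<open>n\<close>, hence below
      \<open>?i\<close>; for negative \<open>n\<close> there are none.\<close>
    let ?i = "Suc (nat n)"
    have "rep_fun (A_lim l) n = rep_fun (A_seq l ?i) n"
      by (rule rep_fun_cong) (use lim_below[OF assms, of _ ?i] in auto)
    also have "\<dots> = rep_fun (B_seq l ?i) n"
      by (simp only: rep_fun_seq_eq[OF assms])
    also have "\<dots> = rep_fun (B_lim l) n"
      by (rule rep_fun_cong) (use lim_below[OF assms, of _ ?i] in auto)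
    finally show "rep_fun (A_lim l) n = rep_fun (B_lim l) n" .
  qed
next
  define c M :: nat where "c = 2 ^ (2 * l) - 1" and "M = 2 ^ (2 * l + 1) - 1"
  have M: "M > 0"
    using m_seq_gt[OF assms, of "2 * l"] m_seq_ge[OF assms, of 0] by (simp add: M_def)
  note tail = seq_tail[OF assms, folded c_def M_def]
  \<comment> \<open>This stage is late enough to decide \<open>x\<close> and has the form required
    by \<open>tail\<close>.\<close>
  have below: "x \<in> A_lim l \<longleftrightarrow> x \<in> A_seq l (2 * l + Suc x)"
    "x \<in> B_lim l \<longleftrightarrow> x \<in> B_seq l (2 * l + Suc x)" for x
    using lim_below[OF assms, of x "2 * l + Suc x"] by auto
  have lt: "x < 2 ^ Suc x" for x :: nat
    using less_exp[of "Suc x"] by linarith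
  show "A_lim l \<union> B_lim l = UNIV"
  proof (intro equalityI subsetI UNIV_I)
    fix x
    have "x < 2 ^ Suc x * M"
      using lt[of x] M by (metis Suc_leI less_le_trans mult.right_neutral mult_le_mono2 One_nat_def)
    then show "x \<in> A_lim l \<union> B_lim l"
      using tail[of "Suc x"] below[of x] by blast
  qed
  have "x \<in> A_lim l \<inter> B_lim l \<longleftrightarrow> x \<in> range (\<lambda>q. c + M * q)" for x
  proof -
    have "x \<in> A_lim l \<inter> B_lim l \<longleftrightarrow> x \<in> (\<lambda>q. c + M * q) ` {..<2 ^ Suc x}"
      using tail[of "Suc x"] below[of x] by blast
    \<comment> \<open>Cutting \<open>q\<close> off at \<open>2 ^ Suc x\<close> loses nothing, as
      \<open>M > 0\<close> forces \<open>q \<le> x\<close>.\<close>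
    moreover have "q < 2 ^ Suc x" if "x = c + M * q" for q
    proof -
      have "q \<le> x"
        using that M by (simp add: trans_le_add2)
      then show ?thesis
        using lt[of x] by linarith
    qed
    ultimately show ?thesis
      by blast
  qed
  then show "A_lim l \<inter> B_lim l = (+) (2 ^ (2 * l) - 1) ` ((*) (2 ^ (2 * l + 1) - 1) ` UNIV)"
    unfolding c_def[symmetric] M_def[symmetric] image_image by blast
qed

end
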